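(* Let $X$ be a real Hilbert space, let $\mathbb{E}$ be a finite-dimensional Euclidean space, let $D\subseteq X$ be a nonempty weakly sequentially closed set, let $\mathcal{P}\subseteq\mathbb{E}$ be a nonempty closed set with $0\notin\mathcal{P}$, and let $(T_p)_{p\in\mathcal{P}}$ be a family of operators $T_p:X\to X$. Suppose that there exists a continuous function $\eta:\mathcal{P}\to(0,+\infty)$ such that for all $p\in\mathcal{P}$ the operator $T_p$ is conically $\eta(p)$-averaged, and suppose that for all $z\in X$ the mapping $\mathcal{P}\ni p\mapsto T_pz\in X$ is (strongly) continuous. Then the operator $$D\times\mathcal{P}\to X,\qquad (x,p)\mapsto(\mathrm{Id}-T_p)x$$ is parametrically demiclosed.
   Context: An operator $T:X\to X$ is conically $\eta$-averaged ($\eta>0$) if for all $x,y\in X$, $\|Tx-Ty\|^2+\frac{1-\eta}{\eta}\|(\mathrm{Id}-T)x-(\mathrm{Id}-T)y\|^2\le\|x-y\|^2$; equivalently, there is a nonexpansive ($1$-Lipschitz) operator $N:X\to X$ with $T=(1-\eta)\mathrm{Id}+\eta N$. An operator $G:D\times\mathcal{P}\to X$ is parametrically demiclosed if its graph is sequentially closed in $(X^{\text{weak}}\times\mathbb{E})\times X^{\text{strong}}$, where $X^{\text{weak}}$ and $X^{\text{strong}}$ denote $X$ with the weak and the norm topology; i.e., whenever $x_k\in D$ converges weakly to $x$, $p_k\in\mathcal{P}$ converges to $p$, and $G(x_k,p_k)$ converges strongly to $u$, then $(x,p)\in D\times\mathcal{P}$ and $G(x,p)=u$. *)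

theory Defs
  imports "HOL-Analysis.Analysis"
begin

(* The weak topology: the initial topology for evaluation against all continuous linear
   functionals.  The function space carries the product topology. *)
definition weak_topology :: "'a::real_normed_vector topology"
  where "weak_topology =
    pullback_topology UNIV (\<lambda>x (f :: 'a \<Rightarrow>\<^sub>L real). blinfun_apply f x) euclidean"

definition sequentially_closedin :: "'a topology \<Rightarrow> 'a set \<Rightarrow> bool"
  where "sequentially_closedin X S \<longleftrightarrow>
    S \<subseteq> topspace X \<and>
    (\<forall>\<sigma> l. (\<forall>n::nat. \<sigma> n \<in> S) \<and> limitin X \<sigma> l sequentially \<longrightarrow> l \<in> S)"

definition conically_averaged :: "real \<Rightarrow> ('a::real_normed_vector \<Rightarrow> 'a) \<Rightarrow> bool"
  where "conically_averaged \<eta> T \<longleftrightarrow>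
    \<eta> > 0 \<and>
    (\<forall>x y. (norm (T x - T y))\<^sup>2 + (1 - \<eta>) / \<eta> * (norm ((x - T x) - (y - T y)))\<^sup>2
           \<le> (norm (x - y))\<^sup>2)"

(* G is a total function; only its restriction to D \<times> P matters.  The graph is required to be
   sequentially closed in the whole ambient space, so limits are not assumed to lie over D \<times> P. *)
definition parametrically_demiclosed ::
    "'a::real_normed_vector set \<Rightarrow> 'e::euclidean_space set \<Rightarrow> ('a \<times> 'e \<Rightarrow> 'a) \<Rightarrow> bool"
  where "parametrically_demiclosed D P G \<longleftrightarrow>
    sequentially_closedin
      (prod_topology (prod_topology weak_topology euclidean) euclidean)
      {(z, G z) | z. z \<in> D \<times> P}"

lemma topspace_weak_topology [simp]: "topspace weak_topology = UNIV"
  by (simp add: weak_topology_def topspace_pullback_topology)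

lemma limitin_weak_topology_iff:
  fixes \<sigma> :: "'b \<Rightarrow> 'a::real_normed_vector"
  shows "limitin weak_topology \<sigma> l F \<longleftrightarrow>
    (\<forall>f :: 'a \<Rightarrow>\<^sub>L real. ((\<lambda>n. blinfun_apply f (\<sigma> n)) \<longlongrightarrow> blinfun_apply f l) F)"
proof -
  let ?ev = "\<lambda>x (f :: 'a \<Rightarrow>\<^sub>L real). blinfun_apply f x"
  have "limitin weak_topology \<sigma> l F \<longleftrightarrow> ((\<lambda>n. ?ev (\<sigma> n)) \<longlongrightarrow> ?ev l) F"
    unfolding limitin_def tendsto_def weak_topology_def
    by (auto simp: openin_pullback_topology topspace_pullback_topology)
  also have "\<dots> \<longleftrightarrow> limitin (product_topology (\<lambda>_. euclidean) UNIV) (\<lambda>n. ?ev (\<sigma> n)) (?ev l) F"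
    by (simp add: euclidean_product_topology)
  also have "\<dots> \<longleftrightarrow> (\<forall>f. ((\<lambda>n. ?ev (\<sigma> n) f) \<longlongrightarrow> ?ev l f) F)"
    by (simp add: limitin_componentwise)
  finally show ?thesis .
qed

lemma parametrically_demiclosed_iff:
  fixes D :: "'a::real_normed_vector set" and P :: "'e::euclidean_space set"
  shows "parametrically_demiclosed D P G \<longleftrightarrow>
    (\<forall>x p l q u. (\<forall>n::nat. x n \<in> D \<and> p n \<in> P) \<and> limitin weak_topology x l sequentially \<and>
        p \<longlonglongrightarrow> q \<and> (\<lambda>n. G (x n, p n)) \<longlonglongrightarrow> u
      \<longrightarrow> l \<in> D \<and> q \<in> P \<and> G (l, q) = u)" (is "?L \<longleftrightarrow> ?R")
proof
  assume L: ?L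
  show ?R
  proof (intro allI impI)
    fix x p l q u
    assume *: "(\<forall>n::nat. x n \<in> D \<and> p n \<in> P) \<and> limitin weak_topology x l sequentially \<and>
      p \<longlonglongrightarrow> q \<and> (\<lambda>n. G (x n, p n)) \<longlonglongrightarrow> u"
    define \<sigma> where "\<sigma> n = ((x n, p n), G (x n, p n))" for n
    have "limitin (prod_topology (prod_topology weak_topology euclidean) euclidean)
       \<sigma> ((l, q), u) sequentially"
      using * by (simp add: limitin_pairwise o_def \<sigma>_def)
    moreover have "\<sigma> n \<in> {(z, G z) | z. z \<in> D \<times> P}" for n
      using * by (simp add: \<sigma>_def)
    ultimately have "((l, q), u) \<in> {(z, G z) | z. z \<in> D \<times> P}"
      using L unfolding parametrically_demiclosed_def sequentially_closedin_def by meson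
    then show "l \<in> D \<and> q \<in> P \<and> G (l, q) = u" by auto
  qed
next
  assume R: ?R
  show ?L
    unfolding parametrically_demiclosed_def sequentially_closedin_def
  proof (intro conjI allI impI)
    fix \<sigma> m
    assume *: "(\<forall>n::nat. \<sigma> n \<in> {(z, G z) | z. z \<in> D \<times> P}) \<and>
      limitin (prod_topology (prod_topology weak_topology euclidean) euclidean) \<sigma> m sequentially"
    obtain l q u where m: "m = ((l, q), u)" by (cases m) auto
    define x where "x n = fst (fst (\<sigma> n))" for n
    define p where "p n = snd (fst (\<sigma> n))" for n
    have "x n \<in> D \<and> p n \<in> P \<and> \<sigma> n = ((x n, p n), G (x n, p n))" for n
    proof -
      have "\<sigma> n \<in> {(z, G z) | z. z \<in> D \<times> P}" using * by blast
      then show ?thesis unfolding x_def p_def by auto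
    qed
    then have D: "\<And>n. x n \<in> D \<and> p n \<in> P" and s: "\<sigma> = (\<lambda>n. ((x n, p n), G (x n, p n)))" by auto
    have "limitin weak_topology x l sequentially \<and> p \<longlonglongrightarrow> q \<and> (\<lambda>n. G (x n, p n)) \<longlonglongrightarrow> u"
      using * unfolding m s by (simp add: limitin_pairwise o_def)
    with D have "l \<in> D \<and> q \<in> P \<and> G (l, q) = u"
      by (intro R[rule_format]) auto
    then show "m \<in> {(z, G z) | z. z \<in> D \<times> P}" unfolding m by auto
  qed (simp add: topspace_prod_topology)
qed

end

theory Submission
  imports Defs
begin

text \<open>Put \<open>G\<^sub>p = Id - T\<^sub>p\<close>. Conical averagedness of \<open>T\<^sub>p\<close> is cocoercivity of \<open>G\<^sub>p\<close>. Applying it to the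
points \<open>x\<^sub>n\<close> and the weak limit \<open>x\<close> gives
\<open>\<parallel>G\<^bsub>p\<^sub>n\<^esub> x\<^sub>n - G\<^bsub>p\<^sub>n\<^esub> x\<parallel>\<^sup>2 \<le> 2 \<eta>(p\<^sub>n) \<langle>x\<^sub>n - x, G\<^bsub>p\<^sub>n\<^esub> x\<^sub>n - G\<^bsub>p\<^sub>n\<^esub> x\<rangle>\<close>.
The inner product pairs a weak null sequence, which is bounded by the uniform boundedness principle,
with a sequence converging strongly to \<open>u - G\<^sub>p x\<close>; hence the right-hand side vanishes in the limit
and \<open>u = G\<^sub>p x\<close>.\<close>

text \<open>Baire category: the closed sets \<open>A k\<close> on which the family is bounded by
  \<open>k\<close> cover the space, so one of them contains a ball. Linearity transfers the bound on
  that ball to the origin.\<close>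

theorem uniform_boundedness_principle:
  fixes f :: "'i \<Rightarrow> 'a::{real_normed_vector, complete_space} \<Rightarrow>\<^sub>L 'b::real_normed_vector"
  assumes pointwise: "\<And>x. bounded (range (\<lambda>i. f i x))"
  shows "bounded (range f)"
proof -
  define A where "A k = {x. \<forall>i. norm (f i x) \<le> real k}" for k
  have "closed (A k)" for k
    unfolding A_def by (intro closed_Collect_all closed_Collect_le continuous_intros)
  moreover have "(\<Union>k. A k) = UNIV"
  proof (intro equalityI subset_UNIV subsetI)
    fix x
    obtain B where B: "\<And>i. norm (f i x) \<le> B"
      using pointwise[of x] by (auto simp: bounded_iff)
    obtain k where "B \<le> real k"
      using real_arch_simple by blast
    then have "x \<in> A k"
      unfolding A_def using B order_trans by blast
    then show "x \<in> (\<Union>k. A k)" by blast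
  qed
  ultimately obtain k where "interior (A k) \<noteq> {}"
    using Baire_category_alt[of "euclidean :: 'a topology" "range A"]
      completely_metrizable_space_euclidean
    by auto
  then obtain x r where "r > 0" and r: "cball x r \<subseteq> A k"
    by (meson ex_in_conv mem_interior_cball)
  have "norm (f i) \<le> 2 * real k / r" for i
  proof (rule norm_blinfun_bound)
    fix y
    show "norm (f i y) \<le> 2 * real k / r * norm y"
    proof (cases "y = 0")
      case False
      \<comment> \<open>This scaling gives \<open>c *\<^sub>R y\<close> norm \<open>r\<close>, so
        \<open>x + c *\<^sub>R y\<close> stays in the ball.\<close>
      define c where "c = r / norm y"
      have "c > 0"
        using \<open>r > 0\<close> False by (simp add: c_def)
      have "x + c *\<^sub>R y \<in> A k" "x \<in> A k"
        using r \<open>r > 0\<close> by (auto simp: c_def dist_norm subset_iff)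
      then have "norm (f i (x + c *\<^sub>R y)) \<le> k" "norm (f i x) \<le> k"
        by (auto simp: A_def)
      moreover have "c *\<^sub>R f i y = f i (x + c *\<^sub>R y) - f i x"
        by (simp add: blinfun.add_right blinfun.scaleR_right)
      ultimately have "norm (c *\<^sub>R f i y) \<le> 2 * real k"
        by (smt (verit) norm_triangle_ineq4)
      then show ?thesis
        using \<open>c > 0\<close> \<open>r > 0\<close> False by (simp add: c_def field_simps)
    qed simp
  qed (use \<open>r > 0\<close> in simp)
  then show ?thesis
    by (auto simp: bounded_iff)
qed

lemma weakly_convergent_inner:
  fixes x :: "'b \<Rightarrow> 'a::real_inner"
  assumes "limitin weak_topology x l F"
  shows "((\<lambda>n. x n \<bullet> z) \<longlongrightarrow> l \<bullet> z) F"
  using assms[unfolded limitin_weak_topology_iff, rule_format, of "blinfun_inner_left z"]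
  by simp

text \<open>Regarded as functionals through the inner product, the \<open>x n\<close> are pointwise
  bounded, hence bounded in operator norm.\<close>

lemma weakly_convergent_imp_Bseq:
  fixes x :: "nat \<Rightarrow> 'a::{real_inner, complete_space}"
  assumes "limitin weak_topology x l sequentially"
  shows "Bseq x"
proof -
  have "bounded (range (\<lambda>n. blinfun_inner_right (x n)))"
  proof (rule uniform_boundedness_principle)
    fix z
    have "Bseq (\<lambda>n. x n \<bullet> z)"
      using weakly_convergent_inner[OF assms] by (intro convergent_imp_Bseq convergentI)
    then show "bounded (range (\<lambda>n. blinfun_inner_right (x n) z))"
      by (simp add: Bseq_eq_bounded)
  qed
  then obtain B where B: "\<And>n. norm (blinfun_inner_right (x n)) \<le> B"
    by (auto simp: bounded_iff)
  have "norm (x n) \<le> B" for n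
  proof (cases "x n = 0")
    case False
    \<comment> \<open>Testing the functional on its own representing vector shows that its norm
      dominates \<open>norm (x n)\<close>.\<close>
    have "norm (x n) * norm (x n) = blinfun_inner_right (x n) (x n)"
      by (simp add: dot_square_norm power2_eq_square)
    also have "\<dots> \<le> norm (blinfun_inner_right (x n)) * norm (x n)"
      using norm_blinfun[of "blinfun_inner_right (x n)" "x n"] by simp
    finally show ?thesis
      using False B[of n] by simp
  qed (use B[of n] norm_ge_zero order_trans in \<open>simp, blast\<close>)
  then show ?thesis
    by (rule BseqI')
qed

text \<open>Split \<open>w n\<close> into \<open>w n - v\<close> and \<open>v\<close>: the first
  part is a null sequence paired with a bounded one, and the second needs only weak
  convergence.\<close>

lemma weak_strong_inner_tendsto:
  fixes x :: "nat \<Rightarrow> 'a::{real_inner, complete_space}"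
  assumes x: "limitin weak_topology x l sequentially" and w: "w \<longlonglongrightarrow> v"
  shows "(\<lambda>n. x n \<bullet> w n) \<longlonglongrightarrow> l \<bullet> v"
proof -
  have "(\<lambda>n. x n \<bullet> (w n - v)) \<longlonglongrightarrow> 0"
    using bounded_bilinear.Bfun_prod_Zfun[OF bounded_bilinear_inner weakly_convergent_imp_Bseq[OF x]] w
    by (simp add: tendsto_Zfun_iff)
  then have "(\<lambda>n. x n \<bullet> (w n - v) + x n \<bullet> v) \<longlonglongrightarrow> 0 + l \<bullet> v"
    by (rule tendsto_add) (rule weakly_convergent_inner[OF x])
  then show ?thesis
    by (simp add: inner_diff_right)
qed

lemma conically_averaged_cocoercive:
  fixes T :: "'a::real_inner \<Rightarrow> 'a"
  assumes "conically_averaged \<eta> T"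
  shows "(norm ((x - T x) - (y - T y)))\<^sup>2 \<le> 2 * \<eta> * ((x - y) \<bullet> ((x - T x) - (y - T y)))"
proof -
  define d g where "d = x - y" and "g = (x - T x) - (y - T y)"
  have "\<eta> > 0" and "(norm (T x - T y))\<^sup>2 + (1 - \<eta>) / \<eta> * (norm g)\<^sup>2 \<le> (norm d)\<^sup>2"
    using assms by (auto simp: conically_averaged_def d_def g_def)
  moreover have "T x - T y = d - g"
    by (simp add: d_def g_def)
  \<comment> \<open>Expanding the square of \<open>d - g\<close> cancels the square of
    \<open>norm d\<close>, and the coefficients of the square of \<open>norm g\<close> add up to
    \<open>1 + (1 - \<eta>) / \<eta> = 1 / \<eta>\<close>.\<close>
  ultimately have "(norm g)\<^sup>2 / \<eta> \<le> 2 * (d \<bullet> g)"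
    by (simp add: power2_norm_eq_inner inner_diff_left inner_diff_right inner_commute
        diff_divide_distrib left_diff_distrib)
  then show ?thesis
    unfolding d_def[symmetric] g_def[symmetric] using \<open>\<eta> > 0\<close> by (simp add: field_simps)
qed

theorem corollary2p5:
  fixes D :: "'a::{real_inner, complete_space} set"
    and P :: "'e::euclidean_space set"
    and T :: "'e \<Rightarrow> 'a \<Rightarrow> 'a"
    and \<eta> :: "'e \<Rightarrow> real"
  assumes "D \<noteq> {}"
    and "sequentially_closedin weak_topology D"
    and "P \<noteq> {}"
    and "closed P"
    and "0 \<notin> P"
    and "continuous_on P \<eta>"
    and "\<forall>p\<in>P. \<eta> p > 0"
    and "\<forall>p\<in>P. conically_averaged (\<eta> p) (T p)"
    and "\<forall>z. continuous_on P (\<lambda>p. T p z)"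
  shows "parametrically_demiclosed D P (\<lambda>(x, p). x - T p x)"
  unfolding parametrically_demiclosed_iff
proof (intro allI impI)
  fix x :: "nat \<Rightarrow> 'a" and p :: "nat \<Rightarrow> 'e" and l q u
  assume *: "(\<forall>n. x n \<in> D \<and> p n \<in> P) \<and> limitin weak_topology x l sequentially \<and>
    p \<longlonglongrightarrow> q \<and> (\<lambda>n. case (x n, p n) of (x, p) \<Rightarrow> x - T p x) \<longlonglongrightarrow> u"
  then have x: "\<And>n. x n \<in> D" "limitin weak_topology x l sequentially"
    and p: "\<And>n. p n \<in> P" "p \<longlonglongrightarrow> q"
    and u: "(\<lambda>n. x n - T (p n) (x n)) \<longlonglongrightarrow> u"
    by auto
  have "l \<in> D"
    using assms(2) x unfolding sequentially_closedin_def by blast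
  have "q \<in> P"
    using closed_sequentially[OF \<open>closed P\<close>] p by blast
  have \<eta>: "(\<lambda>n. \<eta> (p n)) \<longlonglongrightarrow> \<eta> q"
    using continuous_on_tendsto_compose[OF assms(6) p(2) \<open>q \<in> P\<close>] p(1) by simp
  have T: "(\<lambda>n. T (p n) l) \<longlonglongrightarrow> T q l"
    using continuous_on_tendsto_compose[OF assms(9)[rule_format] p(2) \<open>q \<in> P\<close>] p(1) by simp
  \<comment> \<open>Both terms use the same parameter \<open>p n\<close>, so cocoercivity of a
    single operator applies; continuity in the parameter is then needed only at the fixed point of
    evaluation \<open>l\<close>.\<close>
  define w v where "w n = (x n - T (p n) (x n)) - (l - T (p n) l)"
    and "v = u - (l - T q l)" for n
  have w: "w \<longlonglongrightarrow> v"
    unfolding w_def v_def by (intro tendsto_intros u T)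
  \<comment> \<open>Both \<open>x n \<bullet> w n\<close> and \<open>l \<bullet> w n\<close> tend to
    \<open>l \<bullet> v\<close>.\<close>
  have "(\<lambda>n. (x n - l) \<bullet> w n) \<longlonglongrightarrow> 0"
    using tendsto_diff[OF weak_strong_inner_tendsto[OF x(2) w] tendsto_inner[OF tendsto_const[of l] w]]
    by (simp add: inner_diff_left)
  then have "(\<lambda>n. 2 * \<eta> (p n) * ((x n - l) \<bullet> w n)) \<longlonglongrightarrow> 2 * \<eta> q * 0"
    by (intro tendsto_intros \<eta>)
  moreover have "(\<lambda>n. (norm (w n))\<^sup>2) \<longlonglongrightarrow> (norm v)\<^sup>2"
    by (intro tendsto_intros w)
  moreover have "(norm (w n))\<^sup>2 \<le> 2 * \<eta> (p n) * ((x n - l) \<bullet> w n)" for n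
    unfolding w_def by (intro conically_averaged_cocoercive assms(8)[rule_format] p(1))
  ultimately have "(norm v)\<^sup>2 \<le> 2 * \<eta> q * 0"
    by (intro LIMSEQ_le) auto
  then have "l - T q l = u"
    by (simp add: v_def)
  then show "l \<in> D \<and> q \<in> P \<and> (case (l, q) of (x, p) \<Rightarrow> x - T p x) = u"
    using \<open>l \<in> D\<close> \<open>q \<in> P\<close> by simp
qed

end
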